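(* Let a layered convex combination of spanning trees $\mathcal{S}$ (with lonely edge sets $L(S)$) be given, let $S$ be a tree in it, and let $F=S\setminus L(S)$. Fix $\gamma\in[0,\tfrac12]$, let $y_F$ be the vector defined in the context, and let $\mathcal{J}_F$ be a random $T_F\triangle\{s,t\}$-join with $\mathbb{E}[\mathcal{J}_F]=y_F$. For an edge set $J$, let $2D_{F+J}$ be the doubled edge set of a minimum $c$-cost spanning tree of the graph obtained by contracting the connected components of $(V,F+J)$. Then $\mathbb{E}\left[c(2D_{F+\mathcal{J}_F})\right]\le\sum_{Q\in\mathcal{Q}(S)}(x^*(Q)-1)\,c(e_S^Q).$
   Context: $V$ is a finite set, $s,t\in V$, $c:\binom V2\to\mathbb{Q}_{\ge0}$ satisfies the triangle inequality. $\delta(U)$ is the set of pairs with exactly one endpoint in $U$. $x^*$ is an optimal solution of the subtour elimination LP for the $s$-$t$ path TSP: minimize $\sum c(e)x(e)$ s.t. $x\ge0$, $x(\delta(\{i\}))=f(\{i\})$ for $i\in V$, $x(\delta(U))\ge f(U)$ for $\emptyset\ne U\subsetneq V$, where $f(U)=1$ if $|U\cap\{s,t\}|=1$ and $2$ otherwise. $E$ is the support of $x^*$; edge sets are identified with incidence vectors and $z(H)=\sum_{e\in H}z(e)$. Narrow cuts: $\mathcal{Q}$ is the set of $Q=\delta(U)\cap E$ ($\emptyset\ne U\subsetneq V$) with $x^*(Q)<2$. $T_X$ denotes the set of odd-degree vertices of an edge set $X$; a $T$-join is an edge set with odd-degree vertex set $T$. $S(s,t)$ is the $s$-$t$ path of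 tree $S$. A convex combination of spanning trees of $(V,E)$, $\lambda_S>0$, $\sum\lambda_S=1$, is viewed as a random tree $\mathcal{S}$; each $S$ has lonely edges $L(S)\subseteq\{e\in S:\exists Q\in\mathcal{Q},Q\cap S=\{e\}\}$; lonely cuts $\mathcal{Q}(S)=\{Q\in\mathcal{Q}:Q\cap S=\{e\},e\in L(S)\}$, with $e_S^Q$ the unique edge of $Q\cap S$; $x^Q(e)=\Pr(Q\in\mathcal{Q}(\mathcal{S}),\ e^Q_{\mathcal{S}}=e)$. A tree $S$ is layered if $Q\in\mathcal{Q}(S)$, $Q'\in\mathcal{Q}$, $x^*(Q')\le x^*(Q)$ imply $Q'\in\mathcal{Q}(S)$. The combination is layered if $\mathbb{E}[\mathcal{S}]=x^*$, $x^Q(Q)=2-x^*(Q)$ for all $Q\in\mathcal{Q}$, and each tree is layered. $y_F=\tfrac12x^*+\gamma S(s,t)+\sum_{Q\in\mathcal{Q}(S):\,x^*(Q)<2-2\gamma}\left(1-\tfrac12x^*(Q)-\gamma\right)e_S^Q+\sum_{Q\in\mathcal{Q}:\,x^*(Q)<2-2\gamma,\ |Q\cap F|\ge2\text{ even}}\frac{1-\frac12x^*(Q)-\gamma}{2-x^*(Q)}x^Q.$ *)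

theory Defs
  imports "HOL-Probability.Probability"
begin

section \<open>Undirected multigraphs\<close>

text \<open>
  A multigraph is given by a set of edge names \<open>X\<close> and a map \<open>ends\<close> sending an edge name to the
  set of its one (loop) or two endpoints. For a simple graph the edges are two-element vertex sets
  and \<open>ends = id\<close>; after a contraction an edge keeps its name and only \<open>ends\<close> changes, so
  loops and parallel edges may appear. A walk is a start vertex together with the list of its
  steps, a step being the edge used and the vertex reached.
\<close>

fun walk :: "('e \<Rightarrow> 'v set) \<Rightarrow> 'e set \<Rightarrow> 'v \<Rightarrow> ('e \<times> 'v) list \<Rightarrow> 'v \<Rightarrow> bool" where
  "walk ends X u [] v \<longleftrightarrow> u = v"
| "walk ends X u ((e, w) # p) v \<longleftrightarrow> e \<in> X \<and> ends e = {u, w} \<and> walk ends X w p v"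

definition path :: "('e \<Rightarrow> 'v set) \<Rightarrow> 'e set \<Rightarrow> 'v \<Rightarrow> ('e \<times> 'v) list \<Rightarrow> 'v \<Rightarrow> bool" where
  "path ends X u p v \<longleftrightarrow> walk ends X u p v \<and> distinct (u # map snd p)"

text \<open>
  Distinctness of the edge names rules out going back and forth along one edge; a loop is a
  cycle of length one and two parallel edges form a cycle of length two.
\<close>

definition cycle :: "('e \<Rightarrow> 'v set) \<Rightarrow> 'e set \<Rightarrow> 'v \<Rightarrow> ('e \<times> 'v) list \<Rightarrow> bool" where
  "cycle ends X u p \<longleftrightarrow>
     walk ends X u p u \<and> p \<noteq> [] \<and> distinct (map fst p) \<and> distinct (map snd p)"

definition connected_graph :: "('e \<Rightarrow> 'v set) \<Rightarrow> 'v set \<Rightarrow> 'e set \<Rightarrow> bool" where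
  "connected_graph ends W X \<longleftrightarrow> (\<forall>u\<in>W. \<forall>v\<in>W. \<exists>p. walk ends X u p v)"

definition spanning_tree :: "('e \<Rightarrow> 'v set) \<Rightarrow> 'v set \<Rightarrow> 'e set \<Rightarrow> 'e set \<Rightarrow> bool" where
  "spanning_tree ends W X S \<longleftrightarrow>
     S \<subseteq> X \<and> connected_graph ends W S \<and> (\<nexists>u p. cycle ends S u p)"

definition min_spanning_tree ::
    "('e \<Rightarrow> real) \<Rightarrow> ('e \<Rightarrow> 'v set) \<Rightarrow> 'v set \<Rightarrow> 'e set \<Rightarrow> 'e set \<Rightarrow> bool" where
  "min_spanning_tree c ends W X D \<longleftrightarrow>
     spanning_tree ends W X D \<and> (\<forall>D'. spanning_tree ends W X D' \<longrightarrow> sum c D \<le> sum c D')"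

section \<open>Edge sets on a vertex set\<close>

definition pairs :: "'a set \<Rightarrow> 'a set set" where
  "pairs V = {e. e \<subseteq> V \<and> card e = 2}"

definition cut :: "'a set \<Rightarrow> 'a set \<Rightarrow> 'a set set" where
  "cut V U = {e \<in> pairs V. card (e \<inter> U) = 1}"

definition odd_vertices :: "'a set \<Rightarrow> 'a set set \<Rightarrow> 'a set" where
  "odd_vertices V X = {v \<in> V. odd (card {e \<in> X. v \<in> e})}"

definition T_join :: "'a set \<Rightarrow> 'a set \<Rightarrow> 'a set set \<Rightarrow> bool" where
  "T_join V T J \<longleftrightarrow> J \<subseteq> pairs V \<and> odd_vertices V J = T"

definition path_edges :: "'a set set \<Rightarrow> 'a \<Rightarrow> 'a \<Rightarrow> 'a set set" where
  "path_edges S u v = fst ` set (THE p. path id S u p v)"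

definition component_of :: "'a set \<Rightarrow> 'a set set \<Rightarrow> 'a \<Rightarrow> 'a set" where
  "component_of V X v = {w \<in> V. \<exists>p. walk id X v p w}"

text \<open>
  \<open>D\<close> is a minimum cost spanning tree of the graph obtained from \<open>(V, E)\<close> by contracting the
  connected components of \<open>(V, X)\<close>: the vertices are these components, and the edge
  \<open>{u, v}\<close> joins the component of \<open>u\<close> to that of \<open>v\<close>.
\<close>

definition min_contracted_tree ::
    "('a set \<Rightarrow> real) \<Rightarrow> 'a set \<Rightarrow> 'a set set \<Rightarrow> 'a set set \<Rightarrow> 'a set set \<Rightarrow> bool" where
  "min_contracted_tree c V E X D \<longleftrightarrow>
     min_spanning_tree c (\<lambda>e. component_of V X ` e) (component_of V X ` V) E D"

section \<open>The subtour elimination LP\<close>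

definition metric_cost :: "'a set \<Rightarrow> ('a set \<Rightarrow> real) \<Rightarrow> bool" where
  "metric_cost V c \<longleftrightarrow>
     (\<forall>e\<in>pairs V. c e \<in> \<rat> \<and> 0 \<le> c e) \<and>
     (\<forall>u\<in>V. \<forall>v\<in>V. \<forall>w\<in>V. u \<noteq> v \<and> v \<noteq> w \<and> u \<noteq> w \<longrightarrow> c {u, w} \<le> c {u, v} + c {v, w})"

definition demand :: "'a \<Rightarrow> 'a \<Rightarrow> 'a set \<Rightarrow> real" where
  "demand s t U = (if card (U \<inter> {s, t}) = 1 then 1 else 2)"

definition subtour_feasible :: "'a set \<Rightarrow> 'a \<Rightarrow> 'a \<Rightarrow> ('a set \<Rightarrow> real) \<Rightarrow> bool" where
  "subtour_feasible V s t x \<longleftrightarrow>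
     (\<forall>e\<in>pairs V. 0 \<le> x e) \<and>
     (\<forall>i\<in>V. sum x (cut V {i}) = demand s t {i}) \<and>
     (\<forall>U. U \<noteq> {} \<and> U \<subset> V \<longrightarrow> demand s t U \<le> sum x (cut V U))"

definition subtour_optimal ::
    "'a set \<Rightarrow> 'a \<Rightarrow> 'a \<Rightarrow> ('a set \<Rightarrow> real) \<Rightarrow> ('a set \<Rightarrow> real) \<Rightarrow> bool" where
  "subtour_optimal V s t c x \<longleftrightarrow>
     subtour_feasible V s t x \<and>
     (\<forall>x'. subtour_feasible V s t x' \<longrightarrow>
        (\<Sum>e\<in>pairs V. c e * x e) \<le> (\<Sum>e\<in>pairs V. c e * x' e))"

definition support :: "'a set \<Rightarrow> ('a set \<Rightarrow> real) \<Rightarrow> 'a set set" where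
  "support V x = {e \<in> pairs V. x e \<noteq> 0}"

definition narrow_cuts :: "'a set \<Rightarrow> ('a set \<Rightarrow> real) \<Rightarrow> 'a set set set" where
  "narrow_cuts V x =
     {Q. (\<exists>U. U \<noteq> {} \<and> U \<subset> V \<and> Q = cut V U \<inter> support V x) \<and> sum x Q < 2}"

section \<open>Lonely edges and layered convex combinations\<close>

definition lonely_cuts ::
    "'a set \<Rightarrow> ('a set \<Rightarrow> real) \<Rightarrow> 'a set set \<Rightarrow> 'a set set \<Rightarrow> 'a set set set" where
  "lonely_cuts V x S L = {Q \<in> narrow_cuts V x. \<exists>e\<in>L. Q \<inter> S = {e}}"

definition lonely_edge :: "'a set set \<Rightarrow> 'a set set \<Rightarrow> 'a set" where
  "lonely_edge S Q = the_elem (Q \<inter> S)"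

text \<open>
  A convex combination of spanning trees with lonely edges is a probability mass function \<open>P\<close>
  on pairs \<open>(S, L)\<close>, where \<open>L\<close> is the lonely edge set \<open>L(S)\<close> of the tree \<open>S\<close>. The members of
  the combination are the pairs in \<open>set_pmf P\<close>, with weights \<open>pmf P (S, L) > 0\<close>. Carrying \<open>L\<close>
  along with \<open>S\<close> also allows one tree to occur several times with different lonely edge sets; if
  \<open>L\<close> is a function of \<open>S\<close>, take the image of the distribution of \<open>S\<close> under
  \<open>\<lambda>S. (S, L S)\<close>.
\<close>

definition lonely_tree_combination ::
    "'a set \<Rightarrow> ('a set \<Rightarrow> real) \<Rightarrow> ('a set set \<times> 'a set set) pmf \<Rightarrow> bool" where
  "lonely_tree_combination V x P \<longleftrightarrow>
     (\<forall>(S, L)\<in>set_pmf P.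
        spanning_tree id V (support V x) S \<and>
        L \<subseteq> {e \<in> S. \<exists>Q\<in>narrow_cuts V x. Q \<inter> S = {e}})"

definition lonely_vector ::
    "'a set \<Rightarrow> ('a set \<Rightarrow> real) \<Rightarrow> ('a set set \<times> 'a set set) pmf \<Rightarrow> 'a set set \<Rightarrow> 'a set \<Rightarrow> real"
  where
  "lonely_vector V x P Q e =
     measure_pmf.prob P {(S, L). Q \<in> lonely_cuts V x S L \<and> lonely_edge S Q = e}"

definition layered_tree ::
    "'a set \<Rightarrow> ('a set \<Rightarrow> real) \<Rightarrow> 'a set set \<Rightarrow> 'a set set \<Rightarrow> bool" where
  "layered_tree V x S L \<longleftrightarrow>
     (\<forall>Q\<in>lonely_cuts V x S L. \<forall>Q'\<in>narrow_cuts V x.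
        sum x Q' \<le> sum x Q \<longrightarrow> Q' \<in> lonely_cuts V x S L)"

definition layered_combination ::
    "'a set \<Rightarrow> ('a set \<Rightarrow> real) \<Rightarrow> ('a set set \<times> 'a set set) pmf \<Rightarrow> bool" where
  "layered_combination V x P \<longleftrightarrow>
     lonely_tree_combination V x P \<and>
     (\<forall>e\<in>pairs V. measure_pmf.expectation P (\<lambda>(S, L). indicat_real S e) = x e) \<and>
     (\<forall>Q\<in>narrow_cuts V x. sum (lonely_vector V x P Q) Q = 2 - sum x Q) \<and>
     (\<forall>(S, L)\<in>set_pmf P. layered_tree V x S L)"

text \<open>The vector \<open>y_F\<close> for the forest \<open>F = S - L\<close>.\<close>

definition y_vector ::
    "'a set \<Rightarrow> 'a \<Rightarrow> 'a \<Rightarrow> ('a set \<Rightarrow> real) \<Rightarrow> ('a set set \<times> 'a set set) pmf \<Rightarrow> real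
      \<Rightarrow> 'a set set \<Rightarrow> 'a set set \<Rightarrow> 'a set \<Rightarrow> real" where
  "y_vector V s t x P \<gamma> S L e =
     x e / 2
     + \<gamma> * indicat_real (path_edges S s t) e
     + (\<Sum>Q | Q \<in> lonely_cuts V x S L \<and> sum x Q < 2 - 2 * \<gamma>.
          (1 - sum x Q / 2 - \<gamma>) * indicat_real {lonely_edge S Q} e)
     + (\<Sum>Q | Q \<in> narrow_cuts V x \<and> sum x Q < 2 - 2 * \<gamma> \<and>
              2 \<le> card (Q \<inter> (S - L)) \<and> even (card (Q \<inter> (S - L))).
          (1 - sum x Q / 2 - \<gamma>) / (2 - sum x Q) * lonely_vector V x P Q e)"

end

theory Submission
  imports Defs
begin

text \<open>
  Let \<open>N\<close> be the set of lonely cuts of \<open>S\<close> and \<open>e Q\<close> the lonely edge of \<open>Q\<close>. By parity a join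
  \<open>J\<close> meets every \<open>Q \<in> N\<close>, and an edge \<open>f \<in> J\<close> closes a cycle with \<open>S\<close> whose lonely edges are the
  \<open>e Q\<close> with \<open>f \<in> Q\<close>. Hence \<open>F + J\<close> becomes connected when, for every \<open>f \<in> J\<close>, all of these
  edges except a most expensive one are added. If \<open>f\<close> lies in two lonely cuts, then \<open>f \<notin> S\<close> and,
  as the combination is layered, \<open>y_F(f) = x(f) / 2\<close>. So the expected cost is at most
  \<open>\<Sum>f. x f * (\<Sum>Q\<ni>f. c (e Q) - max Q\<ni>f. c (e Q))\<close>. The first part equals
  \<open>\<Sum>Q. x(Q) * c (e Q)\<close>. Since \<open>x\<close> is an average of spanning trees, the second part is at least
  \<open>\<Sum>Q. c (e Q)\<close>: the lonely edges form a minimum spanning tree, for the bottleneck cost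
  \<open>f \<mapsto> max Q\<ni>f. c (e Q)\<close>, of the graph in which the components of \<open>F\<close> are contracted.
\<close>

section \<open>Walks, paths and spanning trees\<close>


lemma walk_append:
  "walk ends X u (p @ q) v \<longleftrightarrow> (\<exists>w. walk ends X u p w \<and> walk ends X w q v)"
  by (induction p arbitrary: u) auto

lemma walk_trans:
  "walk ends X u p w \<Longrightarrow> walk ends X w q v \<Longrightarrow> \<exists>r. walk ends X u r v"
  using walk_append[of ends X u p q v] by (intro exI[of _ "p @ q"]) auto

lemma walk_mono: "walk ends X u p v \<Longrightarrow> fst ` set p \<subseteq> Y \<Longrightarrow> walk ends Y u p v"
  by (induction p arbitrary: u) auto

lemma walk_edges: "walk ends X u p v \<Longrightarrow> fst ` set p \<subseteq> X"
  by (induction p arbitrary: u) fastforce+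

lemma walk_sym: "walk ends X u p v \<Longrightarrow> \<exists>q. walk ends X v q u"
proof (induction p arbitrary: u)
  case (Cons a p)
  obtain e w where a: "a = (e, w)" by force
  with Cons obtain q where "walk ends X v q w" "e \<in> X" "ends e = {w, u}"
    by (auto simp: insert_commute)
  then have "walk ends X v (q @ [(e, u)]) u" by (auto simp: walk_append)
  then show ?case by blast
qed (auto intro: exI[of _ "[]"])

lemma walk_edge_ends: "walk ends X u p v \<Longrightarrow> e \<in> fst ` set p \<Longrightarrow> ends e \<subseteq> insert u (snd ` set p)"
proof (induction p arbitrary: u)
  case (Cons a p)
  obtain f w where a: "a = (f, w)" by force
  show ?case
  proof (cases "e = f")
    case False
    then have "ends e \<subseteq> insert w (snd ` set p)" using Cons a by simp
    then show ?thesis using a by auto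
  qed (use Cons.prems a in auto)
qed simp

lemma walk_vertices: "walk ends X u p v \<Longrightarrow> snd ` set p \<subseteq> \<Union> (ends ` X)"
proof (induction p arbitrary: u)
  case (Cons a p)
  obtain f w where a: "a = (f, w)" by force
  then have "w \<in> ends f" "f \<in> X" "snd ` set p \<subseteq> \<Union> (ends ` X)" using Cons by auto
  then show ?case using a by auto
qed simp

text \<open>Used with a truth-valued \<open>\<sigma>\<close>: the vertices where it holds form one
  side of a cut that the edges of \<open>X\<close> avoid.\<close>

lemma walk_invariant:
  assumes "walk ends X u p v"
    and "\<And>e a b. e \<in> X \<Longrightarrow> ends e = {a, b} \<Longrightarrow> \<sigma> a = \<sigma> b"
  shows "\<sigma> u = \<sigma> v"
  using assms(1)
proof (induction p arbitrary: u)
  case (Cons a p)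
  then show ?case using assms(2) by (cases a) fastforce
qed auto

lemma walk_end: "walk ends X u p v \<Longrightarrow> if p = [] then v = u else v \<in> snd ` set p"
  by (induction p arbitrary: u) (fastforce split: if_splits)+

lemma path_Cons:
  "path ends X u ((e, w) # p) v \<longleftrightarrow>
     e \<in> X \<and> ends e = {u, w} \<and> path ends X w p v \<and> u \<noteq> w \<and> u \<notin> snd ` set p"
  by (auto simp: path_def)

lemma walk_imp_path: "walk ends X u p v \<Longrightarrow> \<exists>q. path ends X u q v"
proof (induction p arbitrary: u)
  case Nil
  then show ?case by (auto simp: path_def intro: exI[of _ "[]"])
next
  case (Cons a p)
  obtain e w where a: "a = (e, w)" by force
  with Cons obtain q where q: "path ends X w q v" and e: "e \<in> X" "ends e = {u, w}" by auto
  show ?case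
  proof (cases "u \<in> set (w # map snd q)")
    case False
    with q e have "path ends X u ((e, w) # q) v" by (auto simp: path_def)
    then show ?thesis by blast
  next
    case True
    show ?thesis
    proof (cases "u = w")
      case False
      \<comment> \<open>The path \<open>q\<close> visits \<open>u\<close> later; its part
        \<open>q2\<close> after that visit is already a path from \<open>u\<close>.\<close>
      with True obtain b where "b \<in> set q" "snd b = u" by auto
      then obtain e' q1 q2 where "q = q1 @ (e', u) # q2"
        by (metis split_list surjective_pairing)
      with q have "path ends X u q2 v" by (auto simp: path_def walk_append)
      then show ?thesis by blast
    qed (use q in blast)
  qed
qed

text \<open>An edge at \<open>u\<close> used again later would make the rest of the path visit
  \<open>u\<close>.\<close>

lemma path_distinct_edges: "path ends X u p v \<Longrightarrow> distinct (map fst p)"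
proof (induction p arbitrary: u)
  case (Cons a p)
  obtain e w where a: "a = (e, w)" by force
  with Cons.prems have p: "path ends X w p v" and u: "ends e = {u, w}" "u \<noteq> w" "u \<notin> snd ` set p"
    by (auto simp: path_def)
  have "e \<notin> fst ` set p"
    using walk_edge_ends[of ends X w p v e] p u by (auto simp: path_def)
  with Cons.IH[OF p] a show ?case by auto
qed simp

text \<open>Two paths that leave \<open>u\<close> by different edges close up to a cycle through \<open>u\<close>.\<close>

lemma path_unique:
  assumes "\<nexists>u p. cycle id X u p"
  shows "path id X u p v \<Longrightarrow> path id X u p' v \<Longrightarrow> p = p'"
proof (induction p arbitrary: u p')
  case Nil
  then have "v = u" by (simp add: path_def)
  have "path id X u p' u" using Nil.prems(2) unfolding \<open>v = u\<close> .
  then have "p' = []" using walk_end[of id X u p' u] by (auto simp: path_def split: if_splits)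
  then show ?case by simp
next
  case (Cons a p)
  obtain e w where a: "a = (e, w)" by force
  have ew: "e = {u, w}" "e \<in> X" "path id X w p v" "u \<noteq> w" "u \<notin> snd ` set p"
    using Cons.prems(1) unfolding a path_Cons id_apply by blast+
  have "walk id X w p v" using ew(3) by (simp add: path_def)
  then have "v \<noteq> u" using walk_end[of id X w p v] ew(4,5) by (metis (full_types))
  then have "p' \<noteq> []" using Cons.prems(2) by (auto simp: path_def)
  then obtain a' r where p': "p' = a' # r" by (metis neq_Nil_conv)
  obtain e' w' where a': "a' = (e', w')" by force
  have ew': "e' = {u, w'}" "e' \<in> X" "path id X w' r v" "u \<noteq> w'" "u \<notin> snd ` set r"
    using Cons.prems(2) unfolding p' a' path_Cons id_apply by blast+
  show ?case
  proof (cases "w = w'")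
    case True
    have "p = r" by (rule Cons.IH[OF ew(3)]) (rule ew'(3)[folded True])
    then show ?thesis using ew(1) ew'(1) True unfolding p' a' a by simp
  next
    case False
    \<comment> \<open>Both tails avoid \<open>u\<close>, so they use only edges not at
      \<open>u\<close>. A path from \<open>w\<close> to \<open>w'\<close> within \<open>Y\<close>
      therefore misses both \<open>e\<close> and \<open>e'\<close>.\<close>
    define Y where "Y = {f \<in> X. u \<notin> f}"
    have avoid: "walk id Y z q v" if "path id X z q v" "u \<noteq> z" "u \<notin> snd ` set q" for z q
    proof (rule walk_mono)
      show z: "walk id X z q v" using that(1) by (simp add: path_def)
      show "fst ` set q \<subseteq> Y"
      proof
        fix f assume f: "f \<in> fst ` set q"
        then have "f \<in> X" using walk_edges[OF z] by blast
        moreover have "f \<subseteq> insert z (snd ` set q)" using walk_edge_ends[OF z f] by (simp only: id_apply)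
        ultimately show "f \<in> Y" using that(2,3) unfolding Y_def by blast
      qed
    qed
    obtain r' where "walk id Y v r' w'" using walk_sym[OF avoid[OF ew'(3-5)]] by blast
    then obtain q' where "walk id Y w q' w'" using walk_trans[OF avoid[OF ew(3-5)]] by blast
    then obtain q where q: "path id Y w q w'" using walk_imp_path[of id Y w q' w'] by blast
    have wq: "walk id Y w q w'" using q by (simp add: path_def)
    have "u \<notin> \<Union> (id ` Y)" "e \<notin> Y" "e' \<notin> Y" using ew(1) ew'(1) by (auto simp: Y_def)
    then have u: "u \<notin> snd ` set q" "e \<notin> fst ` set q" "e' \<notin> fst ` set q"
      using walk_vertices[OF wq] walk_edges[OF wq] by blast+
    have "fst ` set q \<subseteq> X" using walk_edges[OF wq] by (auto simp: Y_def)
    with wq have "walk id X w q w'" by (rule walk_mono)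
    moreover have "distinct (map fst q)" using q by (rule path_distinct_edges)
    moreover have "e \<noteq> e'" using ew(1) ew'(1) False by (auto simp: doubleton_eq_iff)
    moreover have "e' = {w', u}" using ew'(1) by blast
    moreover have "distinct (w # map snd q)" using q by (simp add: path_def)
    ultimately have "cycle id X u ((e, w) # q @ [(e', u)])"
      using u ew(1,2,4) ew'(2) unfolding cycle_def walk.simps walk_append id_apply by auto
    then show ?thesis using assms by blast
  qed
qed

text \<open>The description in \<open>path_edges\<close> denotes a path only if exactly one exists:
  connectedness gives existence, acyclicity uniqueness.\<close>

lemma path_edges_subset:
  assumes "spanning_tree id V X S" "u \<in> V" "v \<in> V"
  shows "path_edges S u v \<subseteq> S"
proof -
  have acyclic: "\<nexists>u p. cycle id S u p" and "connected_graph id V S"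
    using assms(1) by (simp_all add: spanning_tree_def)
  then obtain q where "walk id S u q v" using assms(2,3) unfolding connected_graph_def by blast
  then obtain p where p: "path id S u p v" using walk_imp_path[of id S u q v] by blast
  have "(THE p. path id S u p v) = p"
    using p path_unique[OF acyclic _ p] by (intro the_equality)
  moreover have "walk id S u p v" using p by (simp add: path_def)
  ultimately show ?thesis unfolding path_edges_def by (simp only: walk_edges)
qed

text \<open>Every use of \<open>e\<close> in a walk can be replaced by going round the rest of the
  cycle, in either direction.\<close>

lemma connected_graph_remove_cycle_edge:
  assumes "connected_graph ends W X" "cycle ends X u ((e, w) # p)"
  shows "connected_graph ends W (X - {e})"
proof -
  have e: "ends e = {u, w}" "walk ends X w p u" "e \<notin> fst ` set p"
    using assms(2) by (auto simp: cycle_def)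
  then have wu: "walk ends (X - {e}) w p u"
    using walk_edges[OF e(2)] by (intro walk_mono[OF e(2)]) auto
  then obtain r where uw: "walk ends (X - {e}) u r w" using walk_sym by metis
  have "\<exists>q'. walk ends (X - {e}) a q' b" if "walk ends X a q b" for a q b
    using that
  proof (induction q arbitrary: a)
    case Nil
    then show ?case by (auto intro: exI[of _ "[]"])
  next
    case (Cons h q)
    obtain e' z where h: "h = (e', z)" by force
    with Cons obtain q' where q': "walk ends (X - {e}) z q' b" "e' \<in> X" "ends e' = {a, z}" by auto
    show ?case
    proof (cases "e' = e")
      case True
      then have "{a, z} = {u, w}" using q'(3) e(1) by simp
      then consider "a = u" "z = w" | "a = w" "z = u" by (auto simp: doubleton_eq_iff)
      then show ?thesis
      proof cases
        case 1
        then show ?thesis using walk_trans[OF uw] q'(1) by blast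
      next
        case 2
        then show ?thesis using walk_trans[OF wu] q'(1) by blast
      qed
    next
      case False
      then have "walk ends (X - {e}) a ((e', z) # q') b" using q' by simp
      then show ?thesis by blast
    qed
  qed
  then show ?thesis using assms(1) by (fastforce simp: connected_graph_def)
qed

text \<open>As long as a cycle is left, one of its edges is deleted; finiteness makes this
  stop.\<close>

lemma connected_graph_has_spanning_tree:
  assumes "finite H" "connected_graph ends W H" "H \<subseteq> X"
  shows "\<exists>D \<subseteq> H. spanning_tree ends W X D"
  using assms
proof (induction H rule: finite_psubset_induct)
  case (psubset H)
  show ?case
  proof (cases "\<exists>u p. cycle ends H u p")
    case True
    then obtain u e w p where c: "cycle ends H u ((e, w) # p)"
      by (metis cycle_def neq_Nil_conv surj_pair)
    then have "H - {e} \<subset> H" by (auto simp: cycle_def)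
    then show ?thesis
      using psubset.IH connected_graph_remove_cycle_edge[OF psubset.prems(1) c] psubset.prems(2)
      by (meson Diff_subset order_trans)
  qed (use psubset.prems in \<open>auto simp: spanning_tree_def\<close>)
qed

section \<open>Cuts and parity\<close>

lemma finite_pairs: "finite V \<Longrightarrow> finite (pairs V)"
  by (rule finite_subset[of _ "Pow V"]) (auto simp: pairs_def)

lemma pairsE:
  assumes "f \<in> pairs V"
  obtains a b where "f = {a, b}" "a \<noteq> b" "a \<in> V" "b \<in> V"
  using assms by (auto simp: pairs_def card_2_iff)

lemma doubleton_in_pairs: "a \<noteq> b \<Longrightarrow> {a, b} \<in> pairs V \<longleftrightarrow> a \<in> V \<and> b \<in> V"
  by (auto simp: pairs_def)

lemma doubleton_in_cut:
  assumes "a \<noteq> b" "a \<in> V" "b \<in> V"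
  shows "{a, b} \<in> cut V U \<longleftrightarrow> (a \<in> U) \<noteq> (b \<in> U)"
proof -
  have "{a, b} \<inter> U = (if a \<in> U then {a} else {}) \<union> (if b \<in> U then {b} else {})" by auto
  then show ?thesis using assms by (auto simp: cut_def doubleton_in_pairs)
qed

lemma odd_card_sym_diff:
  assumes "finite A" "finite B"
  shows "odd (card (sym_diff A B)) \<longleftrightarrow> odd (card A) \<noteq> odd (card B)"
proof -
  have "card (sym_diff A B) = card (A - B) + card (B - A)"
    using assms by (intro card_Un_disjoint) auto
  moreover have "card A = card (A - B) + card (A \<inter> B)" "card B = card (B - A) + card (A \<inter> B)"
    using assms card_Int_Diff[of A B] card_Int_Diff[of B A] by (simp_all add: Int_commute)
  ultimately show ?thesis by (metis even_add)
qed

text \<open>The sum modulo 2 of the cuts in \<open>insert (cut V U) A\<close> is again a cut, and a connected graph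
  avoids no nonempty cut.\<close>

lemma cut_parity:
  assumes conn: "connected_graph id V S" and "S \<subseteq> E" "E \<subseteq> pairs V" and "finite A"
    and cuts: "\<And>Q. Q \<in> A \<Longrightarrow> \<exists>W. Q = cut V W \<inter> E"
    and S: "\<And>h. h \<in> S \<Longrightarrow> h \<in> cut V U \<longleftrightarrow> odd (card {Q \<in> A. h \<in> Q})"
    and "f \<in> E"
  shows "f \<in> cut V U \<longleftrightarrow> odd (card {Q \<in> A. f \<in> Q})"
proof -
  obtain W where W: "\<And>Q. Q \<in> A \<Longrightarrow> Q = cut V (W Q) \<inter> E" using cuts by metis
  \<comment> \<open>\<open>\<sigma> v\<close> is the parity of the number of sides, among
    \<open>U\<close> and the \<open>W Q\<close>, that contain \<open>v\<close>. An edge of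
    \<open>E\<close> changes it exactly when it crosses an odd number of these cuts.\<close>
  define \<sigma> where "\<sigma> v \<longleftrightarrow> (v \<in> U) \<noteq> odd (card {Q \<in> A. v \<in> W Q})" for v
  have *: "(\<sigma> a = \<sigma> b) \<longleftrightarrow> (({a, b} \<in> cut V U) = odd (card {Q \<in> A. {a, b} \<in> Q}))"
    if ab: "a \<noteq> b" "a \<in> V" "b \<in> V" "{a, b} \<in> E" for a b
  proof -
    have "{Q \<in> A. {a, b} \<in> Q} = {Q \<in> A. {a, b} \<in> cut V (W Q)}" using W ab(4) by blast
    also have "\<dots> = sym_diff {Q \<in> A. a \<in> W Q} {Q \<in> A. b \<in> W Q}"
      using doubleton_in_cut[OF ab(1-3)] by auto
    finally show ?thesis
      using odd_card_sym_diff[of "{Q \<in> A. a \<in> W Q}" "{Q \<in> A. b \<in> W Q}"] \<open>finite A\<close>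
        doubleton_in_cut[OF ab(1-3)] by (auto simp: \<sigma>_def)
  qed
  have step: "\<sigma> a = \<sigma> b" if "h \<in> S" "id h = {a, b}" for h a b
  proof (cases "a = b")
    case False
    have "h = {a, b}" "h \<in> E" "h \<in> pairs V" using that assms(2,3) by auto
    then show ?thesis using *[OF False] S[OF that(1)] doubleton_in_pairs[OF False] by auto
  qed simp
  obtain a b where f: "f = {a, b}" "a \<noteq> b" "a \<in> V" "b \<in> V"
    using \<open>f \<in> E\<close> assms(3) by (meson pairsE subsetD)
  obtain p where "walk id S a p b" using conn f by (auto simp: connected_graph_def)
  then have "\<sigma> a = \<sigma> b" by (rule walk_invariant) (use step in blast)
  then show ?thesis using * f \<open>f \<in> E\<close> by blast
qed

text \<open>With no cuts in \<open>A\<close>, \<open>cut_parity\<close> over all pairs shows that a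
  cut missed by \<open>S\<close> is empty, yet \<open>{a, b}\<close> crosses it.\<close>

lemma connected_graph_crosses_cut:
  assumes "connected_graph id V S" "S \<subseteq> pairs V" "a \<in> V" "a \<in> U" "b \<in> V" "b \<notin> U"
  shows "S \<inter> cut V U \<noteq> {}"
proof
  assume "S \<inter> cut V U = {}"
  moreover have "a \<noteq> b" using assms by auto
  ultimately show False
    using cut_parity[OF assms(1,2) order_refl, of "{}" U "{a, b}"] assms
    by (auto simp: doubleton_in_cut doubleton_in_pairs)
qed

text \<open>Two cuts with the same edges in \<open>S\<close> have a sum modulo 2 that
  \<open>S\<close> does not meet, so no edge of \<open>E\<close> is in that sum.\<close>

lemma cut_eq_of_same_tree_edges:
  assumes "connected_graph id V S" "S \<subseteq> E" "E \<subseteq> pairs V"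
    and "Q = cut V U \<inter> E" "\<exists>W. Q' = cut V W \<inter> E" "Q \<inter> S = Q' \<inter> S"
  shows "Q = Q'"
proof -
  have card1: "odd (card {R \<in> {Q'}. h \<in> R}) \<longleftrightarrow> h \<in> Q'" for h
  proof -
    have "{R \<in> {Q'}. h \<in> R} = (if h \<in> Q' then {Q'} else {})" by auto
    then show ?thesis by simp
  qed
  have "f \<in> cut V U \<longleftrightarrow> f \<in> Q'" if "f \<in> E" for f
    using cut_parity[OF assms(1-3), of "{Q'}" U f] assms(2,4-6) that unfolding card1 by blast
  then show ?thesis using assms(4,5) by blast
qed

text \<open>Linear algebra over the field with two elements: the cuts in \<open>A\<close> are
  independent because each has a private edge \<open>e Q\<close> in \<open>S\<close>, and
  restricting them to the connected \<open>S'\<close> keeps them independent. The dimension count is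
  done by comparing numbers of subsets.\<close>

lemma card_cuts_le_card_crossing_edges:
  assumes "finite V" "E \<subseteq> pairs V" "S \<subseteq> E" "connected_graph id V S'" "S' \<subseteq> E"
    and "finite A" and cuts: "\<And>Q. Q \<in> A \<Longrightarrow> \<exists>W. Q = cut V W \<inter> E"
    and e: "\<And>Q. Q \<in> A \<Longrightarrow> Q \<inter> S = {e Q}" and inj: "inj_on e A"
  shows "card A \<le> card {f \<in> S'. \<exists>Q\<in>A. f \<in> Q}"
proof (rule ccontr)
  let ?B = "{f \<in> S'. \<exists>Q\<in>A. f \<in> Q}"
  \<comment> \<open>\<open>?\<phi> W\<close> is the sum modulo 2 of the cuts in \<open>W\<close>,
    restricted to \<open>S'\<close>. With more cuts than edges in \<open>?B\<close>, two subsets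
    would have equal sums.\<close>
  let ?\<phi> = "\<lambda>W. {f \<in> ?B. odd (card {Q \<in> W. f \<in> Q})}"
  assume "\<not> card A \<le> card ?B"
  moreover have "finite S'" using assms(1,2,5) finite_pairs finite_subset by metis
  ultimately have "card (Pow ?B) < card (Pow A)" using \<open>finite A\<close> by (simp add: card_Pow)
  moreover have "?\<phi> ` Pow A \<subseteq> Pow ?B" by blast
  ultimately have "\<not> inj_on ?\<phi> (Pow A)"
    using card_inj_on_le[of ?\<phi> "Pow A" "Pow ?B"] \<open>finite S'\<close> by force
  then obtain W1 W2 where W: "W1 \<subseteq> A" "W2 \<subseteq> A" "W1 \<noteq> W2" "?\<phi> W1 = ?\<phi> W2"
    by (auto simp: inj_on_def)
  define W where "W = sym_diff W1 W2"
  have fin: "finite W1" "finite W2" using W \<open>finite A\<close> finite_subset by blast+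
  have "even (card {Q \<in> W. h \<in> Q})" if "h \<in> S'" for h
  proof -
    have "odd (card {Q \<in> W1. h \<in> Q}) \<longleftrightarrow> odd (card {Q \<in> W2. h \<in> Q})"
    proof (cases "h \<in> ?B")
      case True
      then show ?thesis using W(4) by blast
    next
      case False
      then have "{Q \<in> W1. h \<in> Q} = {}" "{Q \<in> W2. h \<in> Q} = {}" using W that by blast+
      then show ?thesis by (simp only:)
    qed
    moreover have "{Q \<in> W. h \<in> Q} = sym_diff {Q \<in> W1. h \<in> Q} {Q \<in> W2. h \<in> Q}"
      by (auto simp: W_def)
    ultimately show ?thesis using odd_card_sym_diff[of "{Q \<in> W1. h \<in> Q}" "{Q \<in> W2. h \<in> Q}"] fin
      by simp
  qed
  moreover have "W \<subseteq> A" "finite W" using W fin by (auto simp: W_def)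
  \<comment> \<open>On \<open>S'\<close> the sum of \<open>W\<close> agrees with the empty cut,
    whose side is \<open>{}\<close>; by parity it then does so on all of \<open>E\<close>.\<close>
  moreover have "h \<notin> cut V {}" for h by (simp add: cut_def)
  ultimately have even: "even (card {Q \<in> W. f \<in> Q})" if "f \<in> E" for f
    using cut_parity[OF assms(4,5,2), of W "{}" f] cuts that by blast
  obtain Q where "Q \<in> W" using W by (auto simp: W_def)
  have "e Q \<in> S" using e \<open>Q \<in> W\<close> \<open>W \<subseteq> A\<close> by blast
  \<comment> \<open>The private edge \<open>e Q\<close> lies in exactly one cut of \<open>W\<close>,
    which is an odd number.\<close>
  have "{Q' \<in> W. e Q \<in> Q'} = {Q}"
  proof (intro equalityI subsetI)
    fix Q' assume Q': "Q' \<in> {Q' \<in> W. e Q \<in> Q'}"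
    then have "e Q \<in> Q' \<inter> S" using \<open>e Q \<in> S\<close> by blast
    then have "e Q = e Q'" using e[of Q'] Q' \<open>W \<subseteq> A\<close> by auto
    then show "Q' \<in> {Q}" using inj Q' \<open>Q \<in> W\<close> \<open>W \<subseteq> A\<close> by (auto dest: inj_onD)
  qed (use e \<open>Q \<in> W\<close> \<open>W \<subseteq> A\<close> in blast)
  then show False using even[of "e Q"] \<open>e Q \<in> S\<close> assms(3) by auto
qed

text \<open>A largest \<open>a i\<close> is paired with some \<open>b j\<close> at least as large,
  and both are removed. Superlevel counts for thresholds up to \<open>a i\<close> drop by one on
  each side; above \<open>a i\<close> the left side has none.\<close>

lemma sum_le_of_card_superlevel_le:
  fixes a :: "'i \<Rightarrow> real" and b :: "'j \<Rightarrow> real"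
  assumes "finite A" "finite B" "\<And>y. y \<in> B \<Longrightarrow> 0 \<le> b y"
    and "\<And>\<tau>. card {i \<in> A. \<tau> \<le> a i} \<le> card {j \<in> B. \<tau> \<le> b j}"
  shows "sum a A \<le> sum b B"
  using assms
proof (induction "card A" arbitrary: A B)
  case 0
  then show ?case by (auto intro: sum_nonneg)
next
  case (Suc n)
  then have "A \<noteq> {}" by auto
  obtain i where i: "i \<in> A" "\<And>i'. i' \<in> A \<Longrightarrow> a i' \<le> a i"
    using obtains_MAX[OF \<open>finite A\<close> \<open>A \<noteq> {}\<close>, of a] \<open>finite A\<close>
    by (metis Max_ge finite_imageI imageI)
  have "card {i' \<in> A. a i \<le> a i'} \<noteq> 0" using i Suc.prems(1) by auto
  then have "{j \<in> B. a i \<le> b j} \<noteq> {}" using Suc.prems(4)[of "a i"] by force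
  then obtain j where j: "j \<in> B" "a i \<le> b j" by blast
  have "sum a (A - {i}) \<le> sum b (B - {j})"
  proof (rule Suc.hyps(1))
    show "card {i' \<in> A - {i}. \<tau> \<le> a i'} \<le> card {j' \<in> B - {j}. \<tau> \<le> b j'}" for \<tau>
    proof (cases "\<tau> \<le> a i")
      case True
      have "{i' \<in> A - {i}. \<tau> \<le> a i'} = {i' \<in> A. \<tau> \<le> a i'} - {i}"
        "{j' \<in> B - {j}. \<tau> \<le> b j'} = {j' \<in> B. \<tau> \<le> b j'} - {j}" by auto
      moreover have "i \<in> {i' \<in> A. \<tau> \<le> a i'}" "j \<in> {j' \<in> B. \<tau> \<le> b j'}" using True i j by auto
      ultimately show ?thesis using Suc.prems(4)[of \<tau>] by (simp only: card_Diff_singleton diff_le_mono)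
    next
      case False
      then have "{i' \<in> A - {i}. \<tau> \<le> a i'} = {}" using i(2) by force
      then show ?thesis by (simp only: card.empty le0)
    qed
  qed (use Suc i in auto)
  then show ?case
    using sum.remove[OF Suc.prems(1) i(1), of a] sum.remove[OF Suc.prems(2) j(1), of b] j by simp
qed

section \<open>Reconnecting the forest\<close>

text \<open>A cut missed by all these edges meets \<open>S\<close> only in lonely edges, so it is
  the sum modulo 2 of the cuts \<open>Q\<close> with \<open>e Q\<close> in it. An edge
  \<open>f\<close> of \<open>J\<close> in one of them lies in no other, as only the edge of
  \<open>q f\<close> may have been left out; hence \<open>f\<close> crosses \<open>cut V U\<close>,
  which \<open>J\<close> misses. The choice of \<open>q\<close> is arbitrary.\<close>

lemma reconnecting_edges_cross_cut:
  assumes "E \<subseteq> pairs V" "S \<subseteq> E" "connected_graph id V S"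
    and "finite N" and cuts: "\<And>Q. Q \<in> N \<Longrightarrow> \<exists>W. Q = cut V W \<inter> E"
    and e: "\<And>Q. Q \<in> N \<Longrightarrow> Q \<inter> S = {e Q}" and inj: "inj_on e N"
    and "J \<subseteq> E" and J: "\<And>Q. Q \<in> N \<Longrightarrow> J \<inter> Q \<noteq> {}"
    and "a \<in> V" "a \<in> U" "b \<in> V" "b \<notin> U"
  shows "(S - e ` N \<union> J \<union> e ` (\<Union>f\<in>J. {Q \<in> N. f \<in> Q} - {q f})) \<inter> cut V U \<noteq> {}"
proof
  assume none: "(S - e ` N \<union> J \<union> e ` (\<Union>f\<in>J. {Q \<in> N. f \<in> Q} - {q f})) \<inter> cut V U = {}"
  have noneF: "h \<in> e ` N" if "h \<in> S" "h \<in> cut V U" for h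
    using none that by (simp add: disjoint_iff) (metis Diff_iff Un_iff)
  have noneJ: "f \<notin> cut V U" if "f \<in> J" for f
    using none that by (simp add: disjoint_iff)
  have noneH: "Q = q f" if "f \<in> J" "Q \<in> N" "f \<in> Q" "e Q \<in> cut V U" for f Q
  proof (rule ccontr)
    assume "Q \<noteq> q f"
    with that(1-3) have "e Q \<in> e ` (\<Union>f\<in>J. {Q \<in> N. f \<in> Q} - {q f})" by blast
    with that(4) none show False by (simp add: disjoint_iff)
  qed
  have mem: "h \<in> Q \<longleftrightarrow> h = e Q" if "Q \<in> N" "h \<in> S" for h Q
    using e[OF that(1)] that(2) by (auto simp: set_eq_iff)
  \<comment> \<open>The cuts whose sum modulo 2 is \<open>cut V U\<close>; it suffices that both
    contain the same edges of \<open>S\<close>.\<close>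
  define A where "A = {Q \<in> N. e Q \<in> cut V U}"
  have AN: "A \<subseteq> N" "finite A" using \<open>finite N\<close> by (auto simp: A_def)
  have S: "h \<in> cut V U \<longleftrightarrow> odd (card {Q \<in> A. h \<in> Q})" if "h \<in> S" for h
  proof (cases "h \<in> cut V U")
    case True
    then obtain Q where Q: "Q \<in> N" "h = e Q" using noneF \<open>h \<in> S\<close> by blast
    have "Q' = Q" if "Q' \<in> N" "h \<in> Q'" for Q'
      using mem[OF that(1) \<open>h \<in> S\<close>] that Q inj by (simp add: inj_on_def)
    then have "{Q \<in> A. h \<in> Q} = {Q}" using True Q mem[OF Q(1) \<open>h \<in> S\<close>] by (auto simp: A_def)
    then show ?thesis using True by simp
  next
    case False
    then have "{Q \<in> A. h \<in> Q} = {}" using mem \<open>h \<in> S\<close> by (auto simp: A_def)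
    then have "card {Q \<in> A. h \<in> Q} = 0" by (simp only: card.empty)
    then show ?thesis using False by (simp only: even_zero not_True_eq_False)
  qed
  have "S \<inter> cut V U \<noteq> {}"
    by (rule connected_graph_crosses_cut[of V S a U b]) (use assms in auto)
  then obtain h where h: "h \<in> S" "h \<in> cut V U" by blast
  then obtain Q0 where Q0: "Q0 \<in> N" "e Q0 \<in> cut V U" using noneF by blast
  then obtain f where f: "f \<in> J" "f \<in> Q0" using J by blast
  have "Q \<in> A \<Longrightarrow> f \<in> Q \<Longrightarrow> Q = q f" for Q
    by (rule noneH[OF f(1)]) (simp_all add: A_def)
  moreover have "Q0 \<in> A" using Q0 by (simp add: A_def)
  ultimately have "{Q \<in> A. f \<in> Q} = {Q0}" using f(2) by blast
  moreover have "f \<in> cut V U \<longleftrightarrow> odd (card {Q \<in> A. f \<in> Q})"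
    using cut_parity[OF assms(3,2,1) AN(2) _ S, of f] cuts AN(1) f(1) \<open>J \<subseteq> E\<close> by blast
  ultimately show False using noneJ[OF f(1)] by simp
qed

text \<open>The cut condition makes \<open>H\<close> connect the contracted graph, so
  \<open>H\<close> contains a spanning tree of it, which costs no more than \<open>H\<close> because
  costs are nonnegative.\<close>

lemma min_contracted_tree_le:
  assumes "min_contracted_tree c V E X D" "finite V" "E \<subseteq> pairs V" "\<And>e. e \<in> pairs V \<Longrightarrow> 0 \<le> c e"
    and "X \<subseteq> pairs V" "H \<subseteq> E"
    and cross: "\<And>U a b. a \<in> V \<Longrightarrow> a \<in> U \<Longrightarrow> b \<in> V \<Longrightarrow> b \<notin> U \<Longrightarrow> (X \<union> H) \<inter> cut V U \<noteq> {}"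
  shows "sum c D \<le> sum c H"
proof -
  let ?C = "component_of V X" and ?ends = "\<lambda>e. component_of V X ` e"
  have finH: "finite H" using assms(2,3,6) finite_pairs finite_subset by metis
  have "\<exists>p. walk ?ends H (?C u) p (?C v)" if uv: "u \<in> V" "v \<in> V" for u v
  proof (rule ccontr)
    assume no: "\<nexists>p. walk ?ends H (?C u) p (?C v)"
    \<comment> \<open>\<open>U\<close> is the union of the components reachable from that of
      \<open>u\<close> by edges of \<open>H\<close>. An edge of \<open>H\<close> leaving
      \<open>U\<close> would prolong a walk, and an edge of \<open>X\<close> stays within one
      component.\<close>
    define U where "U = {w \<in> V. \<exists>p. walk ?ends H (?C u) p (?C w)}"
    have "u \<in> U" using uv by (auto simp: U_def intro: exI[of _ "[]"])
    moreover have "v \<notin> U" using no by (simp add: U_def)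
    ultimately obtain g where g: "g \<in> X \<union> H" "g \<in> cut V U" using cross[of u U v] uv by blast
    then have "g \<in> pairs V" by (simp add: cut_def)
    then obtain a b where ab: "g = {a, b}" "a \<noteq> b" "a \<in> V" "b \<in> V" by (rule pairsE)
    then have "(a \<in> U) \<noteq> (b \<in> U)" using g doubleton_in_cut by metis
    then obtain a b where ab: "g = {a, b}" "a \<in> V" "b \<in> V" "a \<in> U" "b \<notin> U"
      using ab by (metis insert_commute)
    then obtain p where p: "walk ?ends H (?C u) p (?C a)" by (auto simp: U_def)
    show False
    proof (cases "g \<in> H")
      case True
      then have "walk ?ends H (?C u) (p @ [(g, ?C b)]) (?C b)" using p ab by (auto simp: walk_append)
      then show False using ab by (auto simp: U_def)
    next
      case False
      then have "g \<in> X" using g by blast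
      have "walk id X b ((g, a) # r) w" if "walk id X a r w" for r w
        using that \<open>g \<in> X\<close> ab(1) by auto
      moreover have "walk id X a ((g, b) # r) w" if "walk id X b r w" for r w
        using that \<open>g \<in> X\<close> ab(1) by auto
      ultimately have "?C a = ?C b" unfolding component_of_def by blast
      then show False using p ab by (auto simp: U_def)
    qed
  qed
  then have "connected_graph ?ends (?C ` V) H" by (auto simp: connected_graph_def)
  then obtain D' where D': "D' \<subseteq> H" "spanning_tree ?ends (?C ` V) E D'"
    using connected_graph_has_spanning_tree[OF finH _ \<open>H \<subseteq> E\<close>] by blast
  then have "sum c D \<le> sum c D'"
    using assms(1) by (auto simp: min_contracted_tree_def min_spanning_tree_def)
  also have "\<dots> \<le> sum c H" using D' finH assms(3,4,6) by (intro sum_mono2) auto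
  finally show ?thesis .
qed

text \<open>Handshake argument: when the incidences between \<open>U\<close> and \<open>X\<close>
  are counted by edges, each edge contributes 0 or 2, as none has exactly one end in
  \<open>U\<close>.\<close>

lemma even_card_odd_vertices_in_uncrossed:
  assumes "finite V" "X \<subseteq> pairs V" "X \<inter> cut V U = {}" "U \<subseteq> V"
  shows "even (card (odd_vertices V X \<inter> U))"
proof -
  have finX: "finite X" using assms finite_pairs finite_subset by metis
  have finU: "finite U" using assms finite_subset by blast
  have eq: "(\<Sum>v\<in>U. card {e \<in> X. v \<in> e}) = (\<Sum>e\<in>X. card {v \<in> U. v \<in> e})"
    using sum_multicount_gen[OF finU finX, of "\<lambda>v e. v \<in> e" "\<lambda>e. card {v \<in> U. v \<in> e}"] by simp
  have ev: "even (card {v \<in> U. v \<in> e})" if "e \<in> X" for e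
  proof -
    have e: "e \<in> pairs V" "e \<notin> cut V U" using assms that by auto
    then obtain a b where ab: "e = {a, b}" "a \<noteq> b" "a \<in> V" "b \<in> V" by (meson pairsE)
    then have "{v \<in> U. v \<in> e} = {} \<or> {v \<in> U. v \<in> e} = e"
      using e doubleton_in_cut[of a b V U] by blast
    moreover have "card e = 2" using ab by simp
    ultimately show ?thesis by (metis card.empty dvd_refl even_zero)
  qed
  have "even (\<Sum>v\<in>U. card {e \<in> X. v \<in> e})" unfolding eq by (rule dvd_sum) (rule ev)
  then have *: "even (card {v \<in> U. odd (card {e \<in> X. v \<in> e})})"
    unfolding even_sum_iff[OF finU] .
  have "odd_vertices V X \<inter> U = {v \<in> U. odd (card {e \<in> X. v \<in> e})}"
    using assms(4) unfolding odd_vertices_def by blast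
  then show ?thesis using * by argo
qed

text \<open>If \<open>J\<close> missed the cut as \<open>F\<close> does, both would have an even
  number of odd-degree vertices in \<open>U\<close>; but these numbers differ in parity, because
  \<open>card (U \<inter> {s, t})\<close> is odd.\<close>

lemma T_join_crosses_cut:
  assumes "finite V" "U \<subseteq> V" "odd (card (U \<inter> {s, t}))"
    and "F \<subseteq> pairs V" "F \<inter> cut V U = {}" "T_join V (sym_diff (odd_vertices V F) {s, t}) J"
  shows "J \<inter> cut V U \<noteq> {}"
proof
  assume "J \<inter> cut V U = {}"
  then have "even (card (odd_vertices V J \<inter> U))"
    using assms(1,2,6) by (intro even_card_odd_vertices_in_uncrossed) (simp_all add: T_join_def)
  moreover have "even (card (odd_vertices V F \<inter> U))"
    using assms by (intro even_card_odd_vertices_in_uncrossed)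
  moreover have "odd_vertices V J \<inter> U = sym_diff (odd_vertices V F \<inter> U) (U \<inter> {s, t})"
    using assms(6) by (auto simp: T_join_def)
  moreover have "finite (odd_vertices V F \<inter> U)" using assms(1,2) finite_subset by blast
  ultimately show False
    using odd_card_sym_diff[of "odd_vertices V F \<inter> U" "U \<inter> {s, t}"] assms(3) by simp
qed


lemma sum_UNION_le:
  fixes w :: "'b \<Rightarrow> real"
  assumes "finite J" "\<And>f. f \<in> J \<Longrightarrow> finite (A f)" "\<And>f i. f \<in> J \<Longrightarrow> i \<in> A f \<Longrightarrow> 0 \<le> w i"
  shows "sum w (\<Union>f\<in>J. A f) \<le> (\<Sum>f\<in>J. sum w (A f))"
  using assms
proof (induction J rule: finite_induct)
  case (insert j J)
  have "sum w (A j \<union> (\<Union>f\<in>J. A f)) \<le> sum w (A j) + sum w (\<Union>f\<in>J. A f)"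
  proof -
    have "0 \<le> sum w (A j \<inter> (\<Union>f\<in>J. A f))" using insert.prems(2) by (intro sum_nonneg) auto
    moreover have "finite (A j)" "finite (\<Union>f\<in>J. A f)" using insert.prems(1) insert.hyps by auto
    ultimately show ?thesis using sum.union_inter[of "A j" "\<Union>f\<in>J. A f" w] by linarith
  qed
  also have "sum w (\<Union>f\<in>J. A f) \<le> (\<Sum>f\<in>J. sum w (A f))" using insert by auto
  finally show ?case using insert.hyps by simp
qed simp

text \<open>For each \<open>f\<close> in \<open>J\<close> the edges \<open>e Q\<close> of the cuts
  containing \<open>f\<close> are added, with \<open>q f\<close> spared. An edge added on behalf of
  several \<open>f\<close> is paid for each time.\<close>

lemma contracted_tree_cost_le:
  assumes "min_contracted_tree c V E (S - e ` N \<union> J) D" "finite V" "E \<subseteq> pairs V"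
    and c: "\<And>f. f \<in> pairs V \<Longrightarrow> 0 \<le> c f" and "S \<subseteq> E" "connected_graph id V S"
    and "finite N" and cuts: "\<And>Q. Q \<in> N \<Longrightarrow> \<exists>W. Q = cut V W \<inter> E"
    and e: "\<And>Q. Q \<in> N \<Longrightarrow> Q \<inter> S = {e Q}" and inj: "inj_on e N"
    and "J \<subseteq> E" and J: "\<And>Q. Q \<in> N \<Longrightarrow> J \<inter> Q \<noteq> {}"
  shows "sum c D \<le> (\<Sum>f\<in>J. \<Sum>Q\<in>{Q \<in> N. f \<in> Q} - {q f}. c (e Q))"
proof -
  let ?R = "\<Union>f\<in>J. {Q \<in> N. f \<in> Q} - {q f}"
  have eQ: "e Q \<in> E" "0 \<le> c (e Q)" if "Q \<in> N" for Q
  proof -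
    show "e Q \<in> E" using e[OF that] assms(5) by blast
    then show "0 \<le> c (e Q)" using c assms(3) by blast
  qed
  have "sum c D \<le> sum c (e ` ?R)"
  proof (rule min_contracted_tree_le[OF assms(1-3) c])
    show "S - e ` N \<union> J \<subseteq> pairs V" "e ` ?R \<subseteq> E" using assms(3,5,11) eQ(1) by auto
    show "(S - e ` N \<union> J \<union> e ` ?R) \<inter> cut V U \<noteq> {}"
      if "a \<in> V" "a \<in> U" "b \<in> V" "b \<notin> U" for U a b
      by (rule reconnecting_edges_cross_cut[OF assms(3,5-7) cuts e inj assms(11) J that])
  qed
  also have "\<dots> \<le> sum (c \<circ> e) ?R"
  proof (rule sum_image_le)
    show "finite ?R" by (rule finite_subset[OF _ \<open>finite N\<close>]) auto
  qed (use eQ in auto)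
  also have "\<dots> \<le> (\<Sum>f\<in>J. \<Sum>Q\<in>{Q \<in> N. f \<in> Q} - {q f}. c (e Q))"
    unfolding comp_def
    using finite_subset[OF \<open>J \<subseteq> E\<close>] finite_subset[OF assms(3) finite_pairs[OF assms(2)]] \<open>finite N\<close> eQ(2)
    by (intro sum_UNION_le) auto
  finally show ?thesis .
qed

text \<open>For costs assigning to \<open>f\<close> the largest \<open>c (e Q)\<close> of the cuts \<open>Q \<in> N\<close> it crosses, the
  edges \<open>e Q\<close> form a minimum spanning tree after contracting the rest of \<open>S\<close>.\<close>

lemma lonely_cost_le_bottleneck_cost:
  fixes c M :: "'a set \<Rightarrow> real"
  assumes "finite V" "E \<subseteq> pairs V" "S \<subseteq> E" "connected_graph id V S'" "S' \<subseteq> E"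
    and "finite N" and cuts: "\<And>Q. Q \<in> N \<Longrightarrow> \<exists>W. Q = cut V W \<inter> E"
    and e: "\<And>Q. Q \<in> N \<Longrightarrow> Q \<inter> S = {e Q}" and inj: "inj_on e N"
    and M: "\<And>f Q. Q \<in> N \<Longrightarrow> f \<in> Q \<Longrightarrow> c (e Q) \<le> M f" "\<And>f. 0 \<le> M f"
  shows "(\<Sum>Q\<in>N. c (e Q)) \<le> (\<Sum>f\<in>S'. M f)"
proof (rule sum_le_of_card_superlevel_le)
  show finS': "finite S'" using assms(1,2,5) finite_pairs finite_subset by metis
  fix \<tau> :: real
  \<comment> \<open>Every edge in a cut of \<open>?A\<close> has \<open>M\<close> at least
    \<open>\<tau>\<close>, and \<open>S'\<close> has at least \<open>card ?A\<close> such
    edges.\<close>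
  let ?A = "{Q \<in> N. \<tau> \<le> c (e Q)}"
  have "card ?A \<le> card {f \<in> S'. \<exists>Q\<in>?A. f \<in> Q}"
    by (rule card_cuts_le_card_crossing_edges[OF assms(1-5)])
      (use \<open>finite N\<close> cuts e inj in \<open>auto intro: inj_on_subset\<close>)
  also have "\<dots> \<le> card {f \<in> S'. \<tau> \<le> M f}"
    using finS' M(1) by (intro card_mono) (auto intro: order_trans)
  finally show "card ?A \<le> card {f \<in> S'. \<tau> \<le> M f}" .
qed (use assms in auto)

section \<open>The vector \<open>y_F\<close> on lonely cuts\<close>

lemma expectation_weighted_indicator_sum:
  fixes h :: "'b \<Rightarrow> real"
  assumes "finite (set_pmf p)" "finite B"
  shows "measure_pmf.expectation p (\<lambda>\<omega>. \<Sum>f\<in>B. h f * indicat_real (A \<omega>) f)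
    = (\<Sum>f\<in>B. h f * measure_pmf.expectation p (\<lambda>\<omega>. indicat_real (A \<omega>) f))"
  by (subst Bochner_Integration.integral_sum)
    (simp_all add: integrable_measure_pmf_finite[OF assms(1)])

lemma sum_eq_weighted_indicator_sum:
  fixes h :: "'b \<Rightarrow> real"
  assumes "finite B" "A \<subseteq> B"
  shows "sum h A = (\<Sum>f\<in>B. h f * indicat_real A f)"
proof -
  have "{f \<in> B. f \<in> A} = A" using assms(2) by blast
  then have "sum h A = (\<Sum>f\<in>B. if f \<in> A then h f else 0)"
    using sum.inter_filter[OF assms(1), of h "\<lambda>f. f \<in> A"] by (simp only:)
  also have "\<dots> = (\<Sum>f\<in>B. h f * indicat_real A f)" by (rule sum.cong) (simp_all add: indicator_def)
  finally show ?thesis .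
qed

lemma support_subset: "support V x \<subseteq> pairs V"
  by (auto simp: support_def)

lemma narrow_cut_subset: "Q \<in> narrow_cuts V x \<Longrightarrow> Q \<subseteq> support V x"
  by (auto simp: narrow_cuts_def)

lemma finite_narrow_cuts: "finite V \<Longrightarrow> finite (narrow_cuts V x)"
  using finite_pairs[of V] narrow_cut_subset support_subset
  by (intro finite_subset[of "narrow_cuts V x" "Pow (pairs V)"]) blast+

lemma lonely_cuts_subset: "lonely_cuts V x S L \<subseteq> narrow_cuts V x"
  by (auto simp: lonely_cuts_def)

lemma lonely_cut_inter:
  assumes "Q \<in> lonely_cuts V x S L"
  shows "Q \<inter> S = {lonely_edge S Q}" "lonely_edge S Q \<in> L"
proof -
  obtain e where "e \<in> L" "Q \<inter> S = {e}" using assms by (auto simp: lonely_cuts_def)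
  then show "Q \<inter> S = {lonely_edge S Q}" "lonely_edge S Q \<in> L" by (simp_all add: lonely_edge_def)
qed

text \<open>\<open>f\<close> is the lonely edge of both cuts, so they have the same tree edges, and
  these determine a cut.\<close>

lemma lonely_cut_eqI:
  assumes "spanning_tree id V (support V x) S"
    and "Q \<in> lonely_cuts V x S L" "Q' \<in> lonely_cuts V x S L" "f \<in> S" "f \<in> Q" "f \<in> Q'"
  shows "Q = Q'"
proof -
  obtain U where "Q = cut V U \<inter> support V x"
    using assms(2) by (auto simp: lonely_cuts_def narrow_cuts_def)
  moreover have "\<exists>W. Q' = cut V W \<inter> support V x"
    using assms(3) by (auto simp: lonely_cuts_def narrow_cuts_def)
  moreover have "f = lonely_edge S Q" "f = lonely_edge S Q'"
    using lonely_cut_inter(1)[OF assms(2)] lonely_cut_inter(1)[OF assms(3)] assms(4-6) by blast+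
  then have "Q \<inter> S = Q' \<inter> S"
    using lonely_cut_inter(1)[OF assms(2)] lonely_cut_inter(1)[OF assms(3)] by metis
  moreover have "connected_graph id V S" "S \<subseteq> support V x"
    using assms(1) by (simp_all add: spanning_tree_def)
  ultimately show ?thesis using cut_eq_of_same_tree_edges support_subset by blast
qed

text \<open>A side with demand 2 would give a cut of value at least 2, so the demand is 1.
  Restricting a cut to the support does not change its value.\<close>

lemma narrow_cut_demand:
  assumes "subtour_feasible V s t x" "finite V" "Q \<in> narrow_cuts V x"
  obtains U where "U \<subseteq> V" "Q = cut V U \<inter> support V x" "odd (card (U \<inter> {s, t}))"
proof -
  obtain U where U: "U \<noteq> {}" "U \<subset> V" "Q = cut V U \<inter> support V x" "sum x Q < 2"
    using assms(3) by (auto simp: narrow_cuts_def)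
  have "finite (cut V U)" using finite_pairs[OF assms(2)] by (rule finite_subset[rotated]) (auto simp: cut_def)
  then have "sum x Q = sum x (cut V U)"
    unfolding U(3) by (intro sum.mono_neutral_left) (auto simp: cut_def support_def)
  moreover have "demand s t U \<le> sum x (cut V U)"
    using assms(1) U(1,2) by (simp add: subtour_feasible_def)
  ultimately have "card (U \<inter> {s, t}) = 1" using U(4) by (auto simp: demand_def split: if_splits)
  then show ?thesis using that[of U] U by auto
qed

lemma lonely_vector_eq_0:
  assumes "\<And>S L. (S, L) \<in> set_pmf P \<Longrightarrow> Q \<in> lonely_cuts V x S L \<Longrightarrow> lonely_edge S Q \<noteq> f"
  shows "lonely_vector V x P Q f = 0"
  unfolding lonely_vector_def
  using assms by (intro measure_pmf_zero_iff[THEN iffD2]) auto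

text \<open>The path term and the lonely-edge terms vanish because \<open>f\<close> is not in
  \<open>S\<close>. The last sum vanishes by playing off the layering of \<open>S\<close> against
  that of any tree in which \<open>f\<close> would be the lonely edge of a contributing cut.\<close>

lemma y_vector_eq_half:
  assumes "layered_combination V x P" "(S, L) \<in> set_pmf P" "s \<in> V" "t \<in> V"
    and "Q \<in> lonely_cuts V x S L" "f \<in> Q" "f \<notin> S"
  shows "y_vector V s t x P \<gamma> S L f = x f / 2"
proof -
  have tree: "spanning_tree id V (support V x) S'" if "(S', L') \<in> set_pmf P" for S' L'
    using assms(1) that by (auto simp: layered_combination_def lonely_tree_combination_def)
  have layered: "layered_tree V x S' L'" if "(S', L') \<in> set_pmf P" for S' L'
    using assms(1) that by (auto simp: layered_combination_def)
  have "f \<notin> path_edges S s t" using path_edges_subset[OF tree[OF assms(2)] assms(3,4)] assms(7) by blast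
  then have path: "indicat_real (path_edges S s t) f = 0" by simp
  have edge: "indicat_real {lonely_edge S Q'} f = 0" if "Q' \<in> lonely_cuts V x S L" for Q'
  proof -
    have "lonely_edge S Q' \<in> S" using lonely_cut_inter(1)[OF that] by blast
    then show ?thesis using assms(7) by (auto simp: indicator_def)
  qed
  have vec: "lonely_vector V x P Q' f = 0"
    if Q': "Q' \<in> narrow_cuts V x" "2 \<le> card (Q' \<inter> (S - L))" for Q'
  proof (rule lonely_vector_eq_0)
    fix S' L' assume SL': "(S', L') \<in> set_pmf P" and lon: "Q' \<in> lonely_cuts V x S' L'"
    show "lonely_edge S' Q' \<noteq> f"
    proof
      assume f: "lonely_edge S' Q' = f"
      \<comment> \<open>A lonely cut has no edge in \<open>S - L\<close>, but \<open>Q'\<close> has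
        at least two.\<close>
      have no: "Q' \<notin> lonely_cuts V x S L"
      proof
        assume "Q' \<in> lonely_cuts V x S L"
        note inter = lonely_cut_inter[OF this]
        have "Q' \<inter> (S - L) = {}"
          unfolding Int_Diff[symmetric] inter(1) using inter(2) by simp
        then show False using Q'(2) by simp
      qed
      \<comment> \<open>Layering of \<open>S\<close>: a narrow cut of value at most that of the
        lonely \<open>Q\<close> would be lonely too.\<close>
      then have "\<not> sum x Q' \<le> sum x Q"
        using layered[OF assms(2)] assms(5) Q'(1) unfolding layered_tree_def by blast
      then have "sum x Q \<le> sum x Q'" by simp
      moreover have "Q \<in> narrow_cuts V x" using assms(5) lonely_cuts_subset by (rule subsetD[rotated])
      \<comment> \<open>Layering of \<open>S'\<close> now makes \<open>Q\<close> lonely there;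
        \<open>Q\<close> and \<open>Q'\<close> share the edge \<open>f\<close> of \<open>S'\<close>
        and hence coincide.\<close>
      ultimately have "Q \<in> lonely_cuts V x S' L'"
        using layered[OF SL'] lon unfolding layered_tree_def by blast
      moreover have "f \<in> Q'" "f \<in> S'" using lonely_cut_inter(1)[OF lon] f by auto
      ultimately have "Q = Q'" using lonely_cut_eqI[OF tree[OF SL'], of Q L' Q' f] lon assms(6) by simp
      then show False using no assms(5) by simp
    qed
  qed
  show ?thesis unfolding y_vector_def using path edge vec by (simp add: sum.neutral)
qed

text \<open>Serves to confine the joins to the support: an edge of expectation 0 is in no join of
  positive probability.\<close>

lemma y_vector_eq_0_off_support:
  assumes "layered_combination V x P" "(S, L) \<in> set_pmf P" "s \<in> V" "t \<in> V"
    and "f \<in> pairs V" "f \<notin> support V x"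
  shows "y_vector V s t x P \<gamma> S L f = 0"
proof -
  have tree: "spanning_tree id V (support V x) S"
    using assms(1,2) by (auto simp: layered_combination_def lonely_tree_combination_def)
  have "f \<notin> S" using tree assms(6) by (auto simp: spanning_tree_def)
  then have "f \<notin> path_edges S s t" using path_edges_subset[OF tree assms(3,4)] by blast
  then have path: "indicat_real (path_edges S s t) f = 0" by simp
  have edge: "indicat_real {lonely_edge S Q'} f = 0" if "Q' \<in> lonely_cuts V x S L" for Q'
  proof -
    have "lonely_edge S Q' \<in> S" using lonely_cut_inter(1)[OF that] by blast
    then show ?thesis using \<open>f \<notin> S\<close> by (auto simp: indicator_def)
  qed
  have vec: "lonely_vector V x P Q' f = 0" if "Q' \<in> narrow_cuts V x" for Q'
  proof (rule lonely_vector_eq_0)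
    fix S' L' assume "Q' \<in> lonely_cuts V x S' L'"
    then show "lonely_edge S' Q' \<noteq> f"
      using lonely_cut_inter(1)[of Q' V x S' L'] narrow_cut_subset[OF that] assms(6) by blast
  qed
  have "x f = 0" using assms(5,6) by (simp add: support_def)
  then show ?thesis unfolding y_vector_def using path edge vec by (simp add: sum.neutral)
qed

lemma expectation_indicator_neq_0:
  assumes "finite (set_pmf p)" "J \<in> set_pmf p" "f \<in> J"
  shows "measure_pmf.expectation p (\<lambda>J. indicat_real J f) \<noteq> 0"
proof -
  have "pmf p J * 1 \<le> (\<Sum>J\<in>set_pmf p. pmf p J * indicat_real J f)"
    using assms member_le_sum[of J "set_pmf p" "\<lambda>J. pmf p J * indicat_real J f"] by simp
  also have "\<dots> = measure_pmf.expectation p (\<lambda>J. indicat_real J f)"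
    using integral_measure_pmf[OF assms(1), of p "\<lambda>J. indicat_real J f"] by simp
  finally show ?thesis using pmf_positive[OF assms(2)] by simp
qed

theorem theorem4:
  fixes V :: "'a set" and s t :: 'a and c x :: "'a set \<Rightarrow> real"
    and P :: "('a set set \<times> 'a set set) pmf"
    and S L F :: "'a set set" and \<gamma> :: real
    and \<J> :: "'a set set pmf"
    and D :: "'a set set \<Rightarrow> 'a set set"
  assumes "finite V" and "s \<in> V" and "t \<in> V"
    and "metric_cost V c"
    and "subtour_optimal V s t c x"
    and "layered_combination V x P"
    and "(S, L) \<in> set_pmf P" and "F = S - L"
    and "0 \<le> \<gamma>" and "\<gamma> \<le> 1 / 2"
    and "\<And>J. J \<in> set_pmf \<J> \<Longrightarrow> T_join V (sym_diff (odd_vertices V F) {s, t}) J"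
    and "\<And>e. e \<in> pairs V \<Longrightarrow>
           measure_pmf.expectation \<J> (\<lambda>J. indicat_real J e) = y_vector V s t x P \<gamma> S L e"
    and "\<And>J. J \<in> set_pmf \<J> \<Longrightarrow> min_contracted_tree c V (support V x) (F \<union> J) (D J)"
  shows "measure_pmf.expectation \<J> (\<lambda>J. 2 * sum c (D J))
           \<le> (\<Sum>Q\<in>lonely_cuts V x S L. (sum x Q - 1) * c (lonely_edge S Q))"
proof -

  \<comment> \<open>The lonely cuts of \<open>S\<close> and their edges\<close>
  define E where "E = support V x"
  define N where "N = lonely_cuts V x S L"
  define e where "e = lonely_edge S"
  define w where "w Q = c (e Q)" for Q
  define I where "I f = {Q \<in> N. f \<in> Q}" for f
  have E: "E \<subseteq> pairs V" unfolding E_def by (rule support_subset)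
  have finE: "finite (pairs V)" using assms(1) by (rule finite_pairs)
  have feas: "subtour_feasible V s t x" using assms(5) by (simp add: subtour_optimal_def)
  have c: "0 \<le> c f" if "f \<in> pairs V" for f using assms(4) that by (simp add: metric_cost_def)
  have comb: "lonely_tree_combination V x P" using assms(6) by (simp add: layered_combination_def)
  have tree: "S' \<subseteq> E" "connected_graph id V S'" "S' \<subseteq> pairs V" if "(S', L') \<in> set_pmf P" for S' L'
  proof -
    have "spanning_tree id V (support V x) S'"
      using comb that by (auto simp: lonely_tree_combination_def)
    then show "S' \<subseteq> E" "connected_graph id V S'" by (simp_all add: spanning_tree_def E_def)
    then show "S' \<subseteq> pairs V" using E by blast
  qed
  have lonely: "L' \<subseteq> {e \<in> S'. \<exists>Q\<in>narrow_cuts V x. Q \<inter> S' = {e}}" if "(S', L') \<in> set_pmf P" for S' L'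
    using comb that by (auto simp: lonely_tree_combination_def)
  note S = tree[OF assms(7)]
  have finN: "finite N"
    unfolding N_def using lonely_cuts_subset finite_narrow_cuts[OF assms(1)] by (rule finite_subset)
  have narrow: "Q \<in> narrow_cuts V x" if "Q \<in> N" for Q
    using that lonely_cuts_subset unfolding N_def by blast
  have QE: "Q \<subseteq> E" if "Q \<in> N" for Q unfolding E_def using narrow[OF that] by (rule narrow_cut_subset)
  have cuts: "\<exists>W. Q = cut V W \<inter> E" if "Q \<in> N" for Q
    using narrow[OF that] by (auto simp: narrow_cuts_def E_def)
  have eN: "Q \<inter> S = {e Q}" "e Q \<in> L" if "Q \<in> N" for Q
    using lonely_cut_inter that unfolding N_def e_def by blast+
  have eS: "e Q \<in> S" "e Q \<in> Q" if "Q \<in> N" for Q using eN(1)[OF that] by blast+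
  have same: "Q = Q'" if "Q \<in> N" "Q' \<in> N" "f \<in> S" "f \<in> Q" "f \<in> Q'" for Q Q' f
    using lonely_cut_eqI[of V x S Q L Q' f] comb assms(7) that
    by (auto simp: N_def lonely_tree_combination_def)
  have inj: "inj_on e N"
  proof (rule inj_onI)
    fix Q Q' assume "Q \<in> N" "Q' \<in> N" "e Q = e Q'"
    then show "Q = Q'" using same[of Q Q' "e Q"] eS[of Q] eS[of Q'] by metis
  qed
  \<comment> \<open>Every edge of \<open>L\<close> is the only tree edge of some narrow cut, which
    is then in \<open>N\<close>; so \<open>F\<close> is \<open>S\<close> without the edges
    \<open>e Q\<close>.\<close>
  have "L \<subseteq> e ` N"
  proof
    fix f assume f: "f \<in> L"
    then obtain Q where Q: "Q \<in> narrow_cuts V x" "Q \<inter> S = {f}" using lonely[OF assms(7)] by blast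
    then have "Q \<in> N" using f by (auto simp: N_def lonely_cuts_def)
    moreover have "f = e Q" using eN(1)[OF \<open>Q \<in> N\<close>] Q(2) by simp
    ultimately show "f \<in> e ` N" by blast
  qed
  then have L: "L = e ` N" using eN(2) by blast
  have w: "0 \<le> w Q" if "Q \<in> N" for Q
    unfolding w_def using eS(1)[OF that] S(3) by (intro c) blast
  have finI: "finite (I f)" for f using finN by (simp add: I_def)

  \<comment> \<open>A costliest lonely cut for every edge\<close>
  have "\<exists>q. I f \<noteq> {} \<longrightarrow> q \<in> I f \<and> (\<forall>Q\<in>I f. w Q \<le> w q)" for f
  proof (cases "I f = {}")
    case False
    then obtain q where "q \<in> I f" "Max (w ` I f) = w q" using obtains_MAX[OF finI] by metis
    then show ?thesis using Max_ge[OF finite_imageI[OF finI]] by (metis imageI)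
  qed simp
  then obtain q where q: "\<And>f. I f \<noteq> {} \<Longrightarrow> q f \<in> I f"
    "\<And>f Q. Q \<in> I f \<Longrightarrow> w Q \<le> w (q f)" by (metis empty_iff)
  \<comment> \<open>\<open>q f\<close> is arbitrary when \<open>f\<close> is in no lonely cut; the
    value 0 keeps \<open>gM\<close> and \<open>M0\<close> valid for all \<open>f\<close>.\<close>
  define M where "M f = (if I f = {} then 0 else w (q f))" for f
  define g where "g f = sum w (I f - {q f})" for f
  have gM: "g f + M f = sum w (I f)" for f
  proof (cases "I f = {}")
    case False
    then show ?thesis using sum.remove[OF finI q(1), of f w] by (simp add: g_def M_def)
  qed (simp add: g_def M_def)
  have M0: "0 \<le> M f" for f using q(1)[of f] w by (auto simp: M_def I_def)
  have wM: "c (e Q) \<le> M f" if "Q \<in> N" "f \<in> Q" for f Q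
    using q(2)[of Q f] that by (auto simp: M_def I_def w_def)

  \<comment> \<open>The joins stay in the support and cross every lonely cut\<close>
  have Jpairs: "J \<subseteq> pairs V" if "J \<in> set_pmf \<J>" for J
    using assms(11)[OF that] by (simp add: T_join_def)
  then have "set_pmf \<J> \<subseteq> Pow (pairs V)" by blast
  then have finJ: "finite (set_pmf \<J>)" by (rule finite_subset) (simp add: finE)
  have JE: "J \<subseteq> E" if "J \<in> set_pmf \<J>" for J
  proof
    fix f assume "f \<in> J"
    then have f: "f \<in> pairs V" using Jpairs[OF that] by blast
    have "y_vector V s t x P \<gamma> S L f \<noteq> 0"
      using expectation_indicator_neq_0[OF finJ that \<open>f \<in> J\<close>] assms(12)[OF f] by simp
    then show "f \<in> E" using y_vector_eq_0_off_support[OF assms(6,7,2,3) f] unfolding E_def by blast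
  qed
  have hit: "J \<inter> Q \<noteq> {}" if J: "J \<in> set_pmf \<J>" and Q: "Q \<in> N" for J Q
  proof -
    obtain U where U: "U \<subseteq> V" "Q = cut V U \<inter> E" "odd (card (U \<inter> {s, t}))"
      using narrow_cut_demand[OF feas assms(1) narrow[OF Q]] unfolding E_def by blast
    \<comment> \<open>The only tree edge of \<open>Q\<close> is in \<open>L\<close>, so
      \<open>F\<close> misses \<open>Q\<close> and parity forces \<open>J\<close> to cross
      it.\<close>
    have "Q \<inter> S - L = {}" unfolding eN(1)[OF Q] using eN(2)[OF Q] by simp
    moreover have "F \<inter> cut V U \<subseteq> Q \<inter> S - L" unfolding U(2) assms(8) using S(1) by blast
    ultimately have F: "F \<inter> cut V U = {}" by (simp only: subset_empty)
    have "F \<subseteq> pairs V" unfolding assms(8) using S(3) by blast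
    from T_join_crosses_cut[OF assms(1) U(1,3) this F assms(11)[OF J]]
    show ?thesis unfolding U(2) using JE[OF J] by blast
  qed

  \<comment> \<open>Reconnection cost of a join, edge by edge\<close>
  have cost: "2 * sum c (D J) \<le> (\<Sum>f\<in>pairs V. 2 * g f * indicat_real J f)"
    if J: "J \<in> set_pmf \<J>" for J
  proof -
    have "min_contracted_tree c V E (S - e ` N \<union> J) (D J)"
      using assms(13)[OF J] unfolding assms(8) L E_def .
    from contracted_tree_cost_le[OF this assms(1) E c S(1,2) finN cuts eN(1) inj JE[OF J] hit[OF J]]
    have "sum c (D J) \<le> sum g J" by (simp add: g_def I_def w_def)
    also have "\<dots> = (\<Sum>f\<in>pairs V. g f * indicat_real J f)"
      using JE[OF J] E finE by (intro sum_eq_weighted_indicator_sum) auto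
    finally show ?thesis
      unfolding mult.assoc sum_distrib_left[symmetric] by (rule mult_left_mono) simp
  qed
  \<comment> \<open>If \<open>f\<close> is in a lonely cut besides \<open>q f\<close>, it is not a
    tree edge, since a tree edge lies in at most one lonely cut; then \<open>y_vector\<close> is
    \<open>x f / 2\<close>, and the factor 2 for doubling cancels the half. Otherwise
    \<open>g f\<close> is 0.\<close>
  have half: "2 * g f * y_vector V s t x P \<gamma> S L f = x f * g f" for f
  proof (cases "I f - {q f} = {}")
    case False
    then obtain Q where QI: "Q \<in> I f" "Q \<noteq> q f" by blast
    then have Q: "Q \<in> N" "f \<in> Q" "Q \<noteq> q f" by (simp_all add: I_def)
    have "q f \<in> I f" using q(1) QI(1) by blast
    then have "q f \<in> N" "f \<in> q f" by (simp_all add: I_def)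
    then have "f \<notin> S" using same[of Q "q f" f] Q by blast
    then show ?thesis
      using y_vector_eq_half[OF assms(6,7,2,3), of Q f \<gamma>] Q by (simp add: N_def)
  next
    case True
    then have "g f = 0" unfolding g_def by (simp only: sum.empty)
    then show ?thesis by simp
  qed

  \<comment> \<open>Bottleneck costs averaged over the combination\<close>
  have finP: "finite (set_pmf P)"
  proof (rule finite_subset)
    show "set_pmf P \<subseteq> Pow (pairs V) \<times> Pow (pairs V)"
    proof (rule subrelI)
      fix S' L' assume SL': "(S', L') \<in> set_pmf P"
      have "L' \<subseteq> S'" using lonely[OF SL'] by (simp add: subset_iff)
      with tree(3)[OF SL'] show "(S', L') \<in> Pow (pairs V) \<times> Pow (pairs V)"
        unfolding mem_Times_iff by simp
    qed
  qed (use finE in simp)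
  \<comment> \<open>The bound holds for each tree of the combination; as the trees average to
    \<open>x\<close>, it carries over to the weights \<open>x f\<close>.\<close>
  have "sum w N = measure_pmf.expectation P (\<lambda>_. sum w N)" by simp
  also have "\<dots> \<le> measure_pmf.expectation P (\<lambda>\<omega>. \<Sum>f\<in>pairs V. M f * indicat_real (fst \<omega>) f)"
  proof (rule integral_mono_AE)
    show "AE \<omega> in P. sum w N \<le> (\<Sum>f\<in>pairs V. M f * indicat_real (fst \<omega>) f)"
      unfolding AE_measure_pmf_iff
    proof
      fix \<omega> assume "\<omega> \<in> set_pmf P"
      then obtain S' L' where \<omega>: "\<omega> = (S', L')" "(S', L') \<in> set_pmf P" by (cases \<omega>) auto
      have "sum w N \<le> sum M S'"
        unfolding w_def
        using wM M0
        by (intro lonely_cost_le_bottleneck_cost[where c = c and M = M,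
              OF assms(1) E S(1) tree(2,1)[OF \<omega>(2)] finN cuts eN(1) inj])
      then show "sum w N \<le> (\<Sum>f\<in>pairs V. M f * indicat_real (fst \<omega>) f)"
        unfolding \<omega>(1) fst_conv sum_eq_weighted_indicator_sum[OF finE tree(3)[OF \<omega>(2)], of M] .
    qed
  qed (simp_all add: integrable_measure_pmf_finite[OF finP])
  also have "\<dots> = (\<Sum>f\<in>pairs V. M f * measure_pmf.expectation P (\<lambda>\<omega>. indicat_real (fst \<omega>) f))"
    by (rule expectation_weighted_indicator_sum[OF finP finE])
  also have "\<dots> = (\<Sum>f\<in>pairs V. x f * M f)"
  proof (rule sum.cong[OF refl])
    fix f assume "f \<in> pairs V"
    then have "measure_pmf.expectation P (\<lambda>\<omega>. indicat_real (fst \<omega>) f) = x f"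
      using assms(6) unfolding layered_combination_def case_prod_unfold by blast
    then show "M f * measure_pmf.expectation P (\<lambda>\<omega>. indicat_real (fst \<omega>) f) = x f * M f"
      by (simp only: mult.commute)
  qed
  finally have bottleneck: "sum w N \<le> (\<Sum>f\<in>pairs V. x f * M f)" .

  \<comment> \<open>Double counting of the pairs of an edge and a lonely cut containing it.\<close>
  have count: "(\<Sum>f\<in>pairs V. x f * sum w (I f)) = (\<Sum>Q\<in>N. sum x Q * w Q)"
  proof -
    have "(\<Sum>f\<in>pairs V. x f * sum w (I f)) = (\<Sum>f\<in>pairs V. \<Sum>Q\<in>N. if f \<in> Q then x f * w Q else 0)"
    proof (rule sum.cong[OF refl])
      fix f
      show "x f * sum w (I f) = (\<Sum>Q\<in>N. if f \<in> Q then x f * w Q else 0)"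
        unfolding I_def sum_distrib_left by (rule sum.inter_filter[OF finN])
    qed
    also have "\<dots> = (\<Sum>Q\<in>N. \<Sum>f\<in>pairs V. if f \<in> Q then x f * w Q else 0)" by (rule sum.swap)
    also have "\<dots> = (\<Sum>Q\<in>N. sum x Q * w Q)"
    proof (rule sum.cong[OF refl])
      fix Q assume "Q \<in> N"
      then have "{f \<in> pairs V. f \<in> Q} = Q" using QE[of Q] E by blast
      then show "(\<Sum>f\<in>pairs V. if f \<in> Q then x f * w Q else 0) = sum x Q * w Q"
        unfolding sum.inter_filter[OF finE, symmetric] sum_distrib_right by (simp only:)
    qed
    finally show ?thesis .
  qed

  \<comment> \<open>Expected cost of the doubled tree\<close>
  have "measure_pmf.expectation \<J> (\<lambda>J. 2 * sum c (D J))
      \<le> measure_pmf.expectation \<J> (\<lambda>J. \<Sum>f\<in>pairs V. 2 * g f * indicat_real J f)"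
    using cost by (intro integral_mono_AE integrable_measure_pmf_finite finJ) (simp add: AE_measure_pmf_iff)
  also have "\<dots> = (\<Sum>f\<in>pairs V. 2 * g f * measure_pmf.expectation \<J> (\<lambda>J. indicat_real J f))"
    by (rule expectation_weighted_indicator_sum[OF finJ finE])
  also have "\<dots> = (\<Sum>f\<in>pairs V. x f * sum w (I f) - x f * M f)"
  proof (rule sum.cong[OF refl])
    fix f assume "f \<in> pairs V"
    then show "2 * g f * measure_pmf.expectation \<J> (\<lambda>J. indicat_real J f) = x f * sum w (I f) - x f * M f"
      using half[of f] assms(12)[of f] gM[of f, symmetric] by (simp add: algebra_simps)
  qed
  \<comment> \<open>\<open>count\<close> yields the coefficient \<open>sum x Q\<close> of each
    lonely cut, and \<open>bottleneck\<close> takes off 1.\<close>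
  also have "\<dots> \<le> (\<Sum>Q\<in>N. sum x Q * w Q) - sum w N"
    unfolding sum_subtractf count using bottleneck by simp
  also have "\<dots> = (\<Sum>Q\<in>N. (sum x Q - 1) * w Q)"
    by (simp add: sum_subtractf algebra_simps)
  finally show ?thesis by (simp add: N_def w_def e_def)
qed

end
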